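(* Let $r\ge 0$, $\sigma>0$, $T>0$, $S_0>0$, $K_p>0$, $K_c>0$, and let $\mu_p>0$, $\mu_c>0$ satisfy $$\frac{\mu_c}{\mu_p}=\frac{1-\Phi(d_p)}{\Phi(d_c)}.$$ For $a\in\mathbf{R}$ let $S_T=S_0\exp\left(aT-\frac{\sigma^2T}{2}+\sigma w_T\right)$, let $X_T=\mu_p(K_p-S_T)^+ +\mu_c(S_T-K_c)^+$, and let $X_0=\mu_p\,p_{BS}(S_0,K_p,r,T,\sigma)+\mu_c\,c_{BS}(S_0,K_c,r,T,\sigma)$. Then $$\mathbf{E}X_T>e^{rT}X_0\quad\text{for every } a\in\mathbf{R} \text{ with } a\neq r,$$ and $$\mathbf{E}X_T=e^{rT}X_0\quad\text{if } a=r.$$ Moreover, for any $K_p>0$, $K_c>0$, the proportion $\frac{\mu_c}{\mu_p}=\frac{1-\Phi(d_p)}{\Phi(d_c)}$ is the only one which ensures that $\mathbf{E}X_T>e^{rT}X_0$ for all $a\ne r$: for any $\mu_p>0$, $\mu_c>0$ with $\frac{\mu_c}{\mu_p}\neq\frac{1-\Phi(d_p)}{\Phi(d_c)}$ there exists $a\in\mathbf{R}$ such that the average gain is negative, i.e. $\mathbf{E}X_T-e^{rT}X_0<0$ (with $X_T=\mu_p(K_p-S_T)^+ +\mu_c(S_T-K_c)^+$ and $X_0=\mu_p\,p_{BS}(S_0,K_p,r,T,\sigma)+\mu_c\,c_{BS}(S_0,K_c,r,T,\sigma)$ for these $\mu_p,\mu_c$).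
   Context: Market model: on a probability space with measure $\mathbf{P}$ (expectation $\mathbf{E}$) and a standard Brownian motion $w_t$, $t\in[0,T]$, the bond price is $B_t=e^{rt}B_0$ with $B_0>0$, and the stock price satisfies the It\^o equation $dS_t=aS_t\,dt+\sigma S_t\,dw_t$, i.e. $S_t=S_0\exp\left(at-\frac{\sigma^2t}{2}+\sigma w_t\right)$. Here $r\ge0$ is the risk-free rate, $\sigma>0$ the volatility, $S_0>0$ the initial price, and $a\in\mathbf{R}$ the (constant, deterministic) appreciation rate. Black-Scholes prices: $\Phi(x)=\frac{1}{\sqrt{2\pi}}\int_{-\infty}^x e^{-y^2/2}\,dy$. For $S_0,K,T,\sigma>0$ and $r\ge0$ put $$d=\frac{\ln(S_0/K)+T(r+\sigma^2/2)}{\sigma\sqrt{T}},\qquad d^-=d-\sigma\sqrt{T},$$ $$c_{BS}(S_0,K,r,T,\sigma)=S_0\Phi(d)-Ke^{-rT}\Phi(d^-),\qquad p_{BS}(S_0,K,r,T,\sigma)=c_{BS}(S_0,K,r,T,\sigma)-S_0+Ke^{-rT}.$$ These are the prices of the European call and put with strike $K$ and expiration time $T$. The numbers $d_p$ and $d_c$ denote $d$ with $K=K_p$ and $K=K_c$ respectively. Strategy: a vector $(K_p,\mu_p,K_c,\mu_c)$ represents buying at time $0$, at Black-Scholes prices, $\mu_p$ puts with strike $K_p$ and $\mu_c$ calls with strike $K_c$, both with expiration time $T$, and holding until $T$. Its initial wealth is $X_0$, its terminal wealth is $X_T$, and its average gain is $\mathbf{E}X_T-e^{rT}X_0$. Notation: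 $x^+=\max(x,0)$. *)

theory Defs
  imports "HOL-Probability.Probability"
begin

text \<open>Both the vanishing at time 0 and the path continuity are required almost surely only.
  The exceptional sets need not themselves be measurable, only contained in a null set.\<close>

definition standard_brownian_motion :: "'a measure \<Rightarrow> real \<Rightarrow> (real \<Rightarrow> 'a \<Rightarrow> real) \<Rightarrow> bool" where
  "standard_brownian_motion M T w \<longleftrightarrow>
     prob_space M \<and>
     (\<forall>t\<in>{0..T}. w t \<in> borel_measurable M) \<and>
     (AE \<omega> in M. w 0 \<omega> = 0) \<and>
     (\<forall>(n::nat) (t::nat \<Rightarrow> real). 0 \<le> t 0 \<and> (\<forall>i<n. t i < t (Suc i)) \<and> t n \<le> T \<longrightarrow>
        prob_space.indep_vars M (\<lambda>_. borel) (\<lambda>i \<omega>. w (t (Suc i)) \<omega> - w (t i) \<omega>) {..<n}) \<and>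
     (\<forall>s t. 0 \<le> s \<and> s < t \<and> t \<le> T \<longrightarrow>
        distributed M lborel (\<lambda>\<omega>. w t \<omega> - w s \<omega>) (normal_density 0 (sqrt (t - s)))) \<and>
     (AE \<omega> in M. continuous_on {0..T} (\<lambda>t. w t \<omega>))"

definition Phi :: "real \<Rightarrow> real" where
  "Phi x = 1 / sqrt (2 * pi) * (LBINT y:{..x}. exp (- y\<^sup>2 / 2))"

definition bs_d :: "real \<Rightarrow> real \<Rightarrow> real \<Rightarrow> real \<Rightarrow> real \<Rightarrow> real" where
  "bs_d S0 K r T \<sigma> = (ln (S0 / K) + T * (r + \<sigma>\<^sup>2 / 2)) / (\<sigma> * sqrt T)"

definition bs_d_minus :: "real \<Rightarrow> real \<Rightarrow> real \<Rightarrow> real \<Rightarrow> real \<Rightarrow> real" where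
  "bs_d_minus S0 K r T \<sigma> = bs_d S0 K r T \<sigma> - \<sigma> * sqrt T"

definition c_BS :: "real \<Rightarrow> real \<Rightarrow> real \<Rightarrow> real \<Rightarrow> real \<Rightarrow> real" where
  "c_BS S0 K r T \<sigma> =
     S0 * Phi (bs_d S0 K r T \<sigma>) - K * exp (- (r * T)) * Phi (bs_d_minus S0 K r T \<sigma>)"

definition p_BS :: "real \<Rightarrow> real \<Rightarrow> real \<Rightarrow> real \<Rightarrow> real \<Rightarrow> real" where
  "p_BS S0 K r T \<sigma> = c_BS S0 K r T \<sigma> - S0 + K * exp (- (r * T))"

definition stock_price ::
    "real \<Rightarrow> real \<Rightarrow> real \<Rightarrow> (real \<Rightarrow> 'a \<Rightarrow> real) \<Rightarrow> real \<Rightarrow> 'a \<Rightarrow> real" where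
  "stock_price S0 a \<sigma> w t \<omega> = S0 * exp (a * t - \<sigma>\<^sup>2 * t / 2 + \<sigma> * w t \<omega>)"

definition initial_wealth ::
    "real \<Rightarrow> real \<Rightarrow> real \<Rightarrow> real \<Rightarrow> real \<Rightarrow> real \<Rightarrow> real \<Rightarrow> real \<Rightarrow> real" where
  "initial_wealth S0 r T \<sigma> Kp \<mu>p Kc \<mu>c = \<mu>p * p_BS S0 Kp r T \<sigma> + \<mu>c * c_BS S0 Kc r T \<sigma>"

definition terminal_wealth ::
    "real \<Rightarrow> real \<Rightarrow> real \<Rightarrow> (real \<Rightarrow> 'a \<Rightarrow> real) \<Rightarrow> real \<Rightarrow>
     real \<Rightarrow> real \<Rightarrow> real \<Rightarrow> real \<Rightarrow> 'a \<Rightarrow> real" where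
  "terminal_wealth S0 a \<sigma> w T Kp \<mu>p Kc \<mu>c \<omega> =
     \<mu>p * max (Kp - stock_price S0 a \<sigma> w T \<omega>) 0 + \<mu>c * max (stock_price S0 a \<sigma> w T \<omega> - Kc) 0"

end

theory Submission
  imports Defs
begin

text \<open>Under drift \<open>a\<close> the expected payoff equals \<open>exp (a * T)\<close> times the initial wealth
  computed with \<open>a\<close> in place of \<open>r\<close>. Since \<open>S0 * exp (a * T) * \<phi> d = K * \<phi> (d - \<sigma> * sqrt T)\<close>,
  its derivative in \<open>a\<close> is \<open>T * S0 * exp (a * T)\<close> times
  \<open>\<mu>c * \<Phi> d\<^sub>c - \<mu>p * (1 - \<Phi> d\<^sub>p)\<close>, which is strictly increasing in \<open>a\<close>. The prescribed
  proportion says exactly that this factor vanishes at \<open>a = r\<close>, so that the expected payoff then has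
  its strict global minimum there; for any other proportion the derivative at \<open>r\<close> is nonzero and the
  expected payoff drops below its value at \<open>r\<close> on one side.\<close>

section \<open>The normal distribution function\<close>

lemma Phi_eq_LBINT_std_normal_density: "Phi x = (LBINT y:{..x}. std_normal_density y)"
proof -
  have "(LBINT y:{..x}. std_normal_density y)
      = (LBINT y:{..x}. 1 / sqrt (2 * pi) * exp (- y\<^sup>2 / 2))"
    by (simp add: std_normal_density_def)
  then show ?thesis
    by (simp only: Phi_def set_integral_mult_right)
qed

lemma set_integrable_std_normal_density:
  "A \<in> sets borel \<Longrightarrow> set_integrable lborel A std_normal_density"
  unfolding set_integrable_def
  by (rule integrable_mult_indicator) auto

lemma Phi_nonneg: "0 \<le> Phi x"
  unfolding Phi_eq_LBINT_std_normal_density set_lebesgue_integral_def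
  by (rule Bochner_Integration.integral_nonneg) auto

text \<open>Cutting the half-line at \<open>x - 1\<close> writes \<open>Phi\<close> near
  \<open>x\<close> as a constant plus an integral over a compact interval, where the fundamental
  theorem of calculus applies. As \<open>x\<close> is interior to \<open>{x - 1..x + 1}\<close>, the
  derivative within that interval is the full derivative.\<close>

lemma DERIV_Phi: "(Phi has_real_derivative std_normal_density x) (at x)"
proof -
  have cont: "continuous_on A std_normal_density" for A
    unfolding std_normal_density_def by (intro continuous_intros) auto
  have eq: "Phi u = Phi (x - 1) + integral {x - 1..u} std_normal_density" if "u \<in> {x - 1..x + 1}" for u
  proof -
    have split: "{..u} = {..x - 1} \<union> {x - 1<..u}"
      using that by auto
    have "Phi u = Phi (x - 1) + (LBINT y:{x - 1<..u}. std_normal_density y)"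
      unfolding Phi_eq_LBINT_std_normal_density split
      by (rule set_integral_Un) (auto intro: set_integrable_std_normal_density)
    \<comment> \<open>Disjointness of the split forces a half-open interval, while the fundamental
      theorem is stated for closed ones; they differ by one point, a null set.\<close>
    also have "(LBINT y:{x - 1<..u}. std_normal_density y) = (LBINT y:{x - 1..u}. std_normal_density y)"
    proof (rule set_integral_null_delta)
      have "({x - 1<..u} - {x - 1..u}) \<union> ({x - 1..u} - {x - 1<..u}) = {x - 1}"
        using that by auto
      then show "({x - 1<..u} - {x - 1..u}) \<union> ({x - 1..u} - {x - 1<..u}) \<in> null_sets lborel"
        by (simp add: finite_imp_null_set_lborel)
    qed auto
    also have "\<dots> = integral {x - 1..u} std_normal_density"
      by (intro set_borel_integral_eq_integral set_integrable_std_normal_density) auto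
    finally show ?thesis .
  qed
  have "((\<lambda>u. integral {x - 1..u} std_normal_density) has_real_derivative std_normal_density x)
          (at x within {x - 1..x + 1})"
    by (rule integral_has_real_derivative) (auto intro: cont)
  from DERIV_add [OF DERIV_const this, of "Phi (x - 1)"]
  have "(Phi has_real_derivative std_normal_density x) (at x within {x - 1..x + 1})"
    unfolding add_0_left
    by (rule has_field_derivative_transform_within [where d = 1]) (simp_all flip: eq)
  then show ?thesis
    by (simp add: at_within_Icc_at)
qed

lemma Phi_strict_mono:
  assumes "x < y"
  shows "Phi x < Phi y"
proof (rule DERIV_pos_imp_increasing [OF assms])
  show "\<exists>D. (Phi has_real_derivative D) (at u) \<and> 0 < D" for u
    by (intro exI [of _ "std_normal_density u"]) (simp add: DERIV_Phi normal_density_pos)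
qed

lemma Phi_pos: "0 < Phi x"
  using Phi_strict_mono [of "x - 1" x] Phi_nonneg [of "x - 1"] by linarith

text \<open>The reflection \<open>y = m - u\<close> carries the upper tail from \<open>c\<close> to
  the lower tail up to \<open>m - c\<close> and centres the density at 0.\<close>

lemma set_integral_Ici_normal_density_1:
  "(LBINT y:{c..}. normal_density m 1 y) = Phi (m - c)"
proof -
  have "(LBINT y:{c..}. normal_density m 1 y)
      = (LBINT u. indicator {c..} (m + (-1) * u) *\<^sub>R normal_density m 1 (m + (-1) * u))"
    unfolding set_lebesgue_integral_def
    by (subst lborel_integral_real_affine [where t = m and c = "-1"]) auto
  also have "\<dots> = Phi (m - c)"
    unfolding Phi_eq_LBINT_std_normal_density set_lebesgue_integral_def
    by (rule Bochner_Integration.integral_cong) (auto simp: indicator_def normal_density_def)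
  finally show ?thesis .
qed

section \<open>Expected payoffs\<close>

text \<open>Exponential tilting by completing the square: the lognormal factor shifts the mean of
  the Gaussian from 0 to \<open>s\<close>, a one-dimensional Girsanov change of measure.\<close>

lemma exp_mult_std_normal_density:
  "std_normal_density y * exp (s * y - s\<^sup>2 / 2) = normal_density s 1 y"
proof -
  have "- y\<^sup>2 / 2 + (s * y - s\<^sup>2 / 2) = - (y - s)\<^sup>2 / 2"
    by (simp add: power2_diff field_simps)
  then show ?thesis
    by (simp add: normal_density_def flip: exp_add)
qed

text \<open>The call is exercised exactly on the half-line \<open>{s - d..}\<close>. There the stock
  term integrates a Gaussian with mean \<open>s\<close> and the strike term a standard one, and the
  two upper tails are \<open>Phi d\<close> and \<open>Phi (d - s)\<close>. Here \<open>F\<close> is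
  the forward price and \<open>s\<close> the total volatility.\<close>

lemma lognormal_call_std_normal:
  fixes s F K :: real
  assumes "s > 0" "F > 0" "K > 0"
  defines "d \<equiv> ln (F / K) / s + s / 2"
  defines "f \<equiv> \<lambda>y. std_normal_density y * max (F * exp (s * y - s\<^sup>2 / 2) - K) 0"
  shows "integrable lborel f" "integral\<^sup>L lborel f = F * Phi d - K * Phi (d - s)"
proof -
  have exercise: "K \<le> F * exp (s * y - s\<^sup>2 / 2) \<longleftrightarrow> s - d \<le> y" for y
  proof -
    have "K \<le> F * exp (s * y - s\<^sup>2 / 2) \<longleftrightarrow> ln K \<le> ln (F * exp (s * y - s\<^sup>2 / 2))"
      using assms by simp
    also have "\<dots> \<longleftrightarrow> ln K \<le> ln F + (s * y - s\<^sup>2 / 2)"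
      using assms by (simp add: ln_mult)
    also have "\<dots> \<longleftrightarrow> s - d \<le> y"
      using assms by (simp add: d_def ln_div field_simps power2_eq_square)
    finally show ?thesis .
  qed
  have f: "f y = F * (indicator {s - d..} y *\<^sub>R normal_density s 1 y)
      - K * (indicator {s - d..} y *\<^sub>R std_normal_density y)" for y
    using exercise [of y] exp_mult_std_normal_density [of y s]
    by (auto simp: f_def indicator_def max_def algebra_simps)
  have int: "integrable lborel (\<lambda>y. indicator {s - d..} y *\<^sub>R normal_density m 1 y)" for m
    by (rule integrable_mult_indicator) auto
  show "integrable lborel f"
    unfolding f by (intro Bochner_Integration.integrable_diff integrable_mult_right int)
  have "integral\<^sup>L lborel f = F * (LBINT y:{s - d..}. normal_density s 1 y)
      - K * (LBINT y:{s - d..}. std_normal_density y)"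
    unfolding f set_lebesgue_integral_def
    by (simp only: Bochner_Integration.integral_diff integrable_mult_right int
        Bochner_Integration.integral_mult_right_zero)
  then show "integral\<^sup>L lborel f = F * Phi d - K * Phi (d - s)"
    by (simp add: set_integral_Ici_normal_density_1)
qed

lemma lognormal_mean_std_normal:
  fixes s F :: real
  defines "f \<equiv> \<lambda>y. std_normal_density y * (F * exp (s * y - s\<^sup>2 / 2))"
  shows "integrable lborel f" "integral\<^sup>L lborel f = F"
proof -
  have f: "f = (\<lambda>y. F * normal_density s 1 y)"
    unfolding f_def by (simp only: mult.left_commute [of _ F] exp_mult_std_normal_density)
  show "integrable lborel f" "integral\<^sup>L lborel f = F"
    unfolding f by auto
qed

text \<open>Brings \<open>bs_d\<close> into the form of \<open>d\<close> in
  \<open>lognormal_call_std_normal\<close>, with forward \<open>S0 * exp (a * T)\<close> and total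
  volatility \<open>\<sigma> * sqrt T\<close>.\<close>

lemma bs_d_eq:
  assumes "\<sigma> > 0" "T > 0" "S0 > 0" "K > 0"
  shows "bs_d S0 K a T \<sigma> = ln (S0 * exp (a * T) / K) / (\<sigma> * sqrt T) + \<sigma> * sqrt T / 2"
proof -
  have "\<sigma> * sqrt T / 2 = T * \<sigma>\<^sup>2 / 2 / (\<sigma> * sqrt T)"
    using assms by (simp add: field_simps power2_eq_square)
  then show ?thesis
    using assms
    by (simp only: bs_d_def add_divide_distrib [symmetric]) (simp add: ln_div ln_mult algebra_simps)
qed

text \<open>With drift \<open>a\<close> the stock has the law it would have in the risk-neutral
  market with rate \<open>a\<close>, so the undiscounted expectation is the Black-Scholes price at
  rate \<open>a\<close>, compounded at \<open>a\<close>.\<close>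

lemma expectation_terminal_wealth:
  fixes M :: "'a measure"
  assumes bm: "standard_brownian_motion M T w"
    and pos: "\<sigma> > 0" "T > 0" "S0 > 0" "Kp > 0" "Kc > 0"
  shows "prob_space.expectation M (terminal_wealth S0 a \<sigma> w T Kp \<mu>p Kc \<mu>c)
    = exp (a * T) * initial_wealth S0 a T \<sigma> Kp \<mu>p Kc \<mu>c"
proof -
  interpret prob_space M
    using bm by (simp add: standard_brownian_motion_def)
  define s F where "s = \<sigma> * sqrt T" and "F = S0 * exp (a * T)"
  \<comment> \<open>Only increments of \<open>w\<close> have a prescribed law, so the Gaussian is
    built from \<open>w T - w 0\<close>; it agrees with \<open>w T / sqrt T\<close> almost
    surely.\<close>
  define N where "N = (\<lambda>\<omega>. (w T \<omega> - w 0 \<omega>) / sqrt T)"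
  define mean where "mean = (\<lambda>y. F * exp (s * y - s\<^sup>2 / 2))"
  define call where "call = (\<lambda>K y. max (mean y - K) 0)"
  \<comment> \<open>The put is expressed by parity, \<open>(K - S)^+ = (S - K)^+ - S + K\<close>,
    which reduces everything to calls and mirrors the definition of \<open>p_BS\<close>.\<close>
  define payoff where "payoff = (\<lambda>y. \<mu>p * (call Kp y - mean y + Kp) + \<mu>c * call Kc y)"
  have sF: "s > 0" "F > 0"
    using pos by (auto simp: s_def F_def)
  have meas: "w T \<in> borel_measurable M" "w 0 \<in> borel_measurable M"
    and w0: "AE \<omega> in M. w 0 \<omega> = 0"
    using bm pos by (auto simp: standard_brownian_motion_def)
  have "distributed M lborel (\<lambda>\<omega>. w T \<omega> - w 0 \<omega>) (normal_density 0 (sqrt (T - 0)))"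
    using bm pos unfolding standard_brownian_motion_def by blast
  then have dist: "distributed M lborel (\<lambda>\<omega>. w T \<omega> - w 0 \<omega>) (normal_density 0 (sqrt T))"
    by simp
  have N: "distributed M lborel N std_normal_density"
    using normal_standard_normal_convert [of "sqrt T" "\<lambda>\<omega>. w T \<omega> - w 0 \<omega>" 0] dist pos
    by (simp add: N_def)
  have stock: "stock_price S0 a \<sigma> w T \<omega> = mean (N \<omega>)" if "w 0 \<omega> = 0" for \<omega>
    using that pos
    by (simp add: stock_price_def mean_def F_def s_def N_def exp_add [symmetric] power_mult_distrib)
  have call: "integrable lborel (\<lambda>y. std_normal_density y * call K y)"
    "(LBINT y. std_normal_density y * call K y) = exp (a * T) * c_BS S0 K a T \<sigma>"
    if "K > 0" for K
  proof -
    show "integrable lborel (\<lambda>y. std_normal_density y * call K y)"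
      unfolding call_def mean_def by (rule lognormal_call_std_normal(1)) (use sF that in auto)
    show "(LBINT y. std_normal_density y * call K y) = exp (a * T) * c_BS S0 K a T \<sigma>"
      unfolding call_def mean_def lognormal_call_std_normal(2) [OF sF that]
      using pos that
      by (simp add: c_BS_def bs_d_minus_def bs_d_eq F_def s_def algebra_simps exp_minus)
  qed
  have mean: "integrable lborel (\<lambda>y. std_normal_density y * mean y)"
    "(LBINT y. std_normal_density y * mean y) = F"
    unfolding mean_def by (fact lognormal_mean_std_normal)+
  have const: "integrable lborel std_normal_density" "(LBINT y. std_normal_density y) = 1"
    by auto
  have "expectation (terminal_wealth S0 a \<sigma> w T Kp \<mu>p Kc \<mu>c) = expectation (\<lambda>\<omega>. payoff (N \<omega>))"
  proof (rule integral_cong_AE)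
    show "AE \<omega> in M. terminal_wealth S0 a \<sigma> w T Kp \<mu>p Kc \<mu>c \<omega> = payoff (N \<omega>)"
      using w0
      by eventually_elim
        (auto simp: terminal_wealth_def stock payoff_def call_def max_def)
    show "terminal_wealth S0 a \<sigma> w T Kp \<mu>p Kc \<mu>c \<in> borel_measurable M"
      unfolding terminal_wealth_def stock_price_def using meas by measurable
    show "(\<lambda>\<omega>. payoff (N \<omega>)) \<in> borel_measurable M"
      unfolding payoff_def call_def mean_def N_def using meas by measurable
  qed
  also have "\<dots> = (LBINT y. std_normal_density y * payoff y)"
    by (rule distributed_integral [OF N, symmetric]) (auto simp: payoff_def call_def mean_def)
  also have "\<dots> = (LBINT y. \<mu>p * (std_normal_density y * call Kp y - std_normal_density y * mean y
      + Kp * std_normal_density y) + \<mu>c * (std_normal_density y * call Kc y))"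
    by (rule Bochner_Integration.integral_cong) (auto simp: payoff_def algebra_simps)
  also have "\<dots> = \<mu>p * (exp (a * T) * c_BS S0 Kp a T \<sigma> - F + Kp)
      + \<mu>c * (exp (a * T) * c_BS S0 Kc a T \<sigma>)"
    using call [OF pos(4)] call [OF pos(5)] mean const by simp
  also have "\<dots> = exp (a * T) * initial_wealth S0 a T \<sigma> Kp \<mu>p Kc \<mu>c"
    by (simp add: initial_wealth_def p_BS_def F_def algebra_simps exp_minus)
  finally show ?thesis .
qed

section \<open>Dependence on the drift\<close>

lemma bs_d_strict_mono:
  assumes "\<sigma> > 0" "T > 0" "a < b"
  shows "bs_d S0 K a T \<sigma> < bs_d S0 K b T \<sigma>"
  using assms by (auto simp: bs_d_def intro!: divide_strict_right_mono)

text \<open>With \<open>s = \<sigma> * sqrt T\<close>, passing from \<open>d\<close> to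
  \<open>d - s\<close> multiplies the Gaussian density by
  \<open>exp (s * d - s\<^sup>2 / 2)\<close>, and \<open>d\<close> is such that this exponent is the
  logarithm of forward over strike.\<close>

lemma std_normal_density_bs_d_minus:
  assumes "\<sigma> > 0" "T > 0" "S0 > 0" "K > 0"
  shows "K * std_normal_density (bs_d_minus S0 K a T \<sigma>)
    = S0 * exp (a * T) * std_normal_density (bs_d S0 K a T \<sigma>)"
proof -
  define s d where "s = \<sigma> * sqrt T" and "d = bs_d S0 K a T \<sigma>"
  have "s > 0"
    using assms by (simp add: s_def)
  then have "s * d - s\<^sup>2 / 2 = ln (S0 * exp (a * T) / K)"
    using bs_d_eq [OF assms, of a] by (simp add: d_def s_def [symmetric] field_simps power2_eq_square)
  then have "exp (s * d - s\<^sup>2 / 2) = S0 * exp (a * T) / K"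
    using assms by simp
  moreover have "std_normal_density (d - s) = std_normal_density d * exp (s * d - s\<^sup>2 / 2)"
    unfolding exp_mult_std_normal_density by (simp add: normal_density_def power2_commute)
  ultimately show ?thesis
    using assms by (simp add: bs_d_minus_def d_def [symmetric] s_def [symmetric])
qed

text \<open>Both arguments of \<open>Phi\<close> have the same slope \<open>T / s\<close> in
  \<open>a\<close>, so by \<open>std_normal_density_bs_d_minus\<close> the two density terms cancel;
  only the derivative of the factor \<open>S0 * exp (a * T)\<close> survives.\<close>

lemma DERIV_forward_c_BS:
  assumes "\<sigma> > 0" "T > 0" "S0 > 0" "K > 0"
  shows "((\<lambda>a. exp (a * T) * c_BS S0 K a T \<sigma>) has_real_derivative
    T * (S0 * exp (a * T)) * Phi (bs_d S0 K a T \<sigma>)) (at a)"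
proof -
  define s where "s = \<sigma> * sqrt T"
  have d: "((\<lambda>a. bs_d S0 K a T \<sigma>) has_real_derivative T / s) (at a)"
    unfolding bs_d_def s_def using assms by (auto intro!: derivative_eq_intros)
  have dm: "((\<lambda>a. bs_d_minus S0 K a T \<sigma>) has_real_derivative T / s) (at a)"
    unfolding bs_d_minus_def using d by (auto intro!: derivative_eq_intros)
  have eq: "(\<lambda>a. exp (a * T) * c_BS S0 K a T \<sigma>)
      = (\<lambda>a. S0 * exp (a * T) * Phi (bs_d S0 K a T \<sigma>) - K * Phi (bs_d_minus S0 K a T \<sigma>))"
    by (rule ext) (simp add: c_BS_def algebra_simps exp_minus)
  have "((\<lambda>a. S0 * exp (a * T)) has_real_derivative S0 * exp (a * T) * T) (at a)"
    by (auto intro!: derivative_eq_intros)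
  note deriv = DERIV_diff [OF DERIV_mult [OF this DERIV_chain2 [OF DERIV_Phi d]]
      DERIV_cmult [OF DERIV_chain2 [OF DERIV_Phi dm]]]
  have "K * (std_normal_density (bs_d_minus S0 K a T \<sigma>) * (T / s))
      = K * std_normal_density (bs_d_minus S0 K a T \<sigma>) * (T / s)"
    by simp
  also have "\<dots> = std_normal_density (bs_d S0 K a T \<sigma>) * (T / s) * (S0 * exp (a * T))"
    unfolding std_normal_density_bs_d_minus [OF assms] by (simp only: mult_ac)
  finally have cancel: "K * (std_normal_density (bs_d_minus S0 K a T \<sigma>) * (T / s))
      = std_normal_density (bs_d S0 K a T \<sigma>) * (T / s) * (S0 * exp (a * T))" .
  show ?thesis
    unfolding eq by (rule DERIV_cong [OF deriv [of K]]) (simp only: cancel, simp)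
qed

text \<open>For the put, parity adds \<open>- S0 * exp (a * T)\<close>, which turns
  \<open>Phi\<close> into \<open>Phi - 1\<close> in its derivative.\<close>

lemma DERIV_forward_initial_wealth:
  assumes "\<sigma> > 0" "T > 0" "S0 > 0" "Kp > 0" "Kc > 0"
  shows "((\<lambda>a. exp (a * T) * initial_wealth S0 a T \<sigma> Kp \<mu>p Kc \<mu>c) has_real_derivative
    T * (S0 * exp (a * T)) * (\<mu>c * Phi (bs_d S0 Kc a T \<sigma>) - \<mu>p * (1 - Phi (bs_d S0 Kp a T \<sigma>)))) (at a)"
proof -
  have eq: "(\<lambda>a. exp (a * T) * initial_wealth S0 a T \<sigma> Kp \<mu>p Kc \<mu>c)
      = (\<lambda>a. \<mu>p * (exp (a * T) * c_BS S0 Kp a T \<sigma> - S0 * exp (a * T) + Kp)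
          + \<mu>c * (exp (a * T) * c_BS S0 Kc a T \<sigma>))"
    by (rule ext) (simp add: initial_wealth_def p_BS_def algebra_simps exp_minus)
  note call = DERIV_forward_c_BS [OF assms(1-3)]
  have "((\<lambda>a. S0 * exp (a * T)) has_real_derivative T * (S0 * exp (a * T))) (at a)"
    by (auto intro!: derivative_eq_intros)
  note DERIV_add [OF DERIV_cmult [OF DERIV_add [OF DERIV_diff [OF call [OF assms(4)] this] DERIV_const]]
      DERIV_cmult [OF call [OF assms(5)]], of \<mu>p Kp \<mu>c]
  then show ?thesis
    unfolding eq by (rule DERIV_cong) (simp add: algebra_simps)
qed

theorem theorem3p1:
  fixes M :: "'a measure" and w :: "real \<Rightarrow> 'a \<Rightarrow> real"
    and r \<sigma> T S0 Kp Kc :: real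
  assumes "prob_space M"
    and "standard_brownian_motion M T w"
    and "r \<ge> 0" and "\<sigma> > 0" and "T > 0" and "S0 > 0" and "Kp > 0" and "Kc > 0"
  shows
    "(\<forall>\<mu>p>0. \<forall>\<mu>c>0.
        \<mu>c / \<mu>p = (1 - Phi (bs_d S0 Kp r T \<sigma>)) / Phi (bs_d S0 Kc r T \<sigma>) \<longrightarrow>
          (\<forall>a. a \<noteq> r \<longrightarrow>
             prob_space.expectation M (terminal_wealth S0 a \<sigma> w T Kp \<mu>p Kc \<mu>c)
               > exp (r * T) * initial_wealth S0 r T \<sigma> Kp \<mu>p Kc \<mu>c) \<and>
          (\<forall>a. a = r \<longrightarrow>
             prob_space.expectation M (terminal_wealth S0 a \<sigma> w T Kp \<mu>p Kc \<mu>c)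
               = exp (r * T) * initial_wealth S0 r T \<sigma> Kp \<mu>p Kc \<mu>c)) \<and>
     (\<forall>\<mu>p>0. \<forall>\<mu>c>0.
        (\<forall>a. a \<noteq> r \<longrightarrow>
           prob_space.expectation M (terminal_wealth S0 a \<sigma> w T Kp \<mu>p Kc \<mu>c)
             > exp (r * T) * initial_wealth S0 r T \<sigma> Kp \<mu>p Kc \<mu>c) \<longrightarrow>
          \<mu>c / \<mu>p = (1 - Phi (bs_d S0 Kp r T \<sigma>)) / Phi (bs_d S0 Kc r T \<sigma>)) \<and>
     (\<forall>\<mu>p>0. \<forall>\<mu>c>0.
        \<mu>c / \<mu>p \<noteq> (1 - Phi (bs_d S0 Kp r T \<sigma>)) / Phi (bs_d S0 Kc r T \<sigma>) \<longrightarrow>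
          (\<exists>a. prob_space.expectation M (terminal_wealth S0 a \<sigma> w T Kp \<mu>p Kc \<mu>c)
                 - exp (r * T) * initial_wealth S0 r T \<sigma> Kp \<mu>p Kc \<mu>c < 0))"
proof -
  define H where "H = (\<lambda>\<mu>p \<mu>c a. exp (a * T) * initial_wealth S0 a T \<sigma> Kp \<mu>p Kc \<mu>c)"
  \<comment> \<open>The other factor of the derivative of \<open>H\<close>,
    \<open>T * (S0 * exp (a * T))\<close>, is positive, so \<open>g\<close> alone carries the sign
    of the slope.\<close>
  define g where "g = (\<lambda>\<mu>p \<mu>c a. \<mu>c * Phi (bs_d S0 Kc a T \<sigma>) - \<mu>p * (1 - Phi (bs_d S0 Kp a T \<sigma>)))"
  note pos = assms(4-8)
  have E: "prob_space.expectation M (terminal_wealth S0 a \<sigma> w T Kp \<mu>p Kc \<mu>c) = H \<mu>p \<mu>c a" for a \<mu>p \<mu>c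
    unfolding H_def by (rule expectation_terminal_wealth [OF assms(2) pos])
  have H': "(H \<mu>p \<mu>c has_real_derivative T * (S0 * exp (a * T)) * g \<mu>p \<mu>c a) (at a)" for \<mu>p \<mu>c a
    unfolding H_def g_def by (rule DERIV_forward_initial_wealth [OF pos])
  have g_mono: "g \<mu>p \<mu>c a < g \<mu>p \<mu>c b" if "\<mu>p > 0" "\<mu>c > 0" "a < b" for \<mu>p \<mu>c a b
  proof -
    have "\<mu>c * Phi (bs_d S0 Kc a T \<sigma>) < \<mu>c * Phi (bs_d S0 Kc b T \<sigma>)"
      "\<mu>p * Phi (bs_d S0 Kp a T \<sigma>) < \<mu>p * Phi (bs_d S0 Kp b T \<sigma>)"
      using that pos by (auto intro!: mult_strict_left_mono Phi_strict_mono bs_d_strict_mono)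
    then show ?thesis
      by (simp add: g_def algebra_simps)
  qed
  have prop_iff: "\<mu>c / \<mu>p = (1 - Phi (bs_d S0 Kp r T \<sigma>)) / Phi (bs_d S0 Kc r T \<sigma>) \<longleftrightarrow> g \<mu>p \<mu>c r = 0"
    if "\<mu>p > 0" for \<mu>p \<mu>c
    using that Phi_pos [of "bs_d S0 Kc r T \<sigma>"] by (simp add: g_def frac_eq_eq mult_ac)
  have minimum: "H \<mu>p \<mu>c r < H \<mu>p \<mu>c a"
    if "\<mu>p > 0" "\<mu>c > 0" "g \<mu>p \<mu>c r = 0" "a \<noteq> r" for \<mu>p \<mu>c a
  proof -
    have cont: "continuous_on A (H \<mu>p \<mu>c)" for A
      by (meson H' DERIV_isCont continuous_at_imp_continuous_on)
    show ?thesis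
    proof (cases "r < a")
      case True
      show ?thesis
      \<comment> \<open>The slope vanishes at \<open>r\<close>, so its sign is usable only in the
        open interval; continuity of \<open>H\<close> covers the endpoints.\<close>
      proof (rule DERIV_pos_imp_increasing_open [OF True])
        fix x assume "r < x"
        then have "0 < T * (S0 * exp (x * T)) * g \<mu>p \<mu>c x"
          using g_mono [of \<mu>p \<mu>c r x] that pos by simp
        then show "\<exists>y. (H \<mu>p \<mu>c has_real_derivative y) (at x) \<and> 0 < y"
          using H' by blast
      qed (rule cont)
    next
      case False
      then have "a < r"
        using that by simp
      then show ?thesis
      proof (rule DERIV_neg_imp_decreasing_open)
        fix x assume "x < r"
        then have "T * (S0 * exp (x * T)) * g \<mu>p \<mu>c x < 0"
          using g_mono [of \<mu>p \<mu>c x r] that pos by (simp add: mult_pos_neg)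
        then show "\<exists>y. (H \<mu>p \<mu>c has_real_derivative y) (at x) \<and> y < 0"
          using H' by blast
      qed (rule cont)
    qed
  qed
  have loss: "\<exists>a. H \<mu>p \<mu>c a < H \<mu>p \<mu>c r" if "g \<mu>p \<mu>c r \<noteq> 0" for \<mu>p \<mu>c
  proof (cases "g \<mu>p \<mu>c r > 0")
    case True
    then have "0 < T * (S0 * exp (r * T)) * g \<mu>p \<mu>c r"
      using pos by simp
    \<comment> \<open>A positive slope at \<open>r\<close> makes every slightly smaller drift a
      losing one; \<open>r - \<delta> / 2\<close> is one such drift. The other case uses a slightly
      larger drift.\<close>
    from DERIV_pos_inc_left [OF H' this] obtain \<delta>
      where "\<delta> > 0" "\<forall>h>0. h < \<delta> \<longrightarrow> H \<mu>p \<mu>c (r - h) < H \<mu>p \<mu>c r" by blast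
    then show ?thesis
      by (intro exI [of _ "r - \<delta> / 2"]) simp
  next
    case False
    then have "T * (S0 * exp (r * T)) * g \<mu>p \<mu>c r < 0"
      using pos that by (simp add: mult_pos_neg)
    from DERIV_neg_dec_right [OF H' this] obtain \<delta>
      where "\<delta> > 0" "\<forall>h>0. h < \<delta> \<longrightarrow> H \<mu>p \<mu>c (r + h) < H \<mu>p \<mu>c r" by blast
    then show ?thesis
      by (intro exI [of _ "r + \<delta> / 2"]) simp
  qed
  have H_r: "exp (r * T) * initial_wealth S0 r T \<sigma> Kp \<mu>p Kc \<mu>c = H \<mu>p \<mu>c r" for \<mu>p \<mu>c
    by (simp add: H_def)
  show ?thesis
    unfolding E H_r
  proof (intro conjI allI impI)
    fix \<mu>p \<mu>c a :: real
    assume "\<mu>p > 0" "\<mu>c > 0"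
      "\<mu>c / \<mu>p = (1 - Phi (bs_d S0 Kp r T \<sigma>)) / Phi (bs_d S0 Kc r T \<sigma>)" "a \<noteq> r"
    then show "H \<mu>p \<mu>c a > H \<mu>p \<mu>c r"
      by (simp add: prop_iff minimum)
  next
    fix \<mu>p \<mu>c :: real
    assume "\<mu>p > 0" "\<forall>a. a \<noteq> r \<longrightarrow> H \<mu>p \<mu>c a > H \<mu>p \<mu>c r"
    \<comment> \<open>A losing drift supplied by \<open>loss\<close> cannot be \<open>r\<close>, the
      inequality being strict, so it would contradict the assumed gain.\<close>
    then show "\<mu>c / \<mu>p = (1 - Phi (bs_d S0 Kp r T \<sigma>)) / Phi (bs_d S0 Kc r T \<sigma>)"
      unfolding prop_iff [OF \<open>\<mu>p > 0\<close>] using loss [of \<mu>p \<mu>c] by (metis order.asym)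
  next
    fix \<mu>p \<mu>c :: real
    assume "\<mu>p > 0" "\<mu>c / \<mu>p \<noteq> (1 - Phi (bs_d S0 Kp r T \<sigma>)) / Phi (bs_d S0 Kc r T \<sigma>)"
    then show "\<exists>a. H \<mu>p \<mu>c a - H \<mu>p \<mu>c r < 0"
      using loss [of \<mu>p \<mu>c] by (simp add: prop_iff)
  qed simp
qed

end
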